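(* Suppose that $\mathbb{E}[f^\star(X)^2]>0$ and let $\alpha>0$. Then the infinite Centered Random Forest $f^{\mathrm{CRF}}_{\infty,n}$ of depth $k_n\ge\log_2(\alpha n)$ is inconsistent, i.e. $\mathcal{R}(f^{\mathrm{CRF}}_{\infty,n})$ does not converge to $0$ as $n\to\infty$.
   Context: Regression setting: $X$ is uniform on $[0,1]^d$, $Y=f^\star(X)+\varepsilon$ with $f^\star(x)=\mathbb{E}[Y\mid X=x]$, and almost surely $\mathbb{E}[\varepsilon\mid X]=0$ and $\mathbb{V}[\varepsilon\mid X]\le\sigma^2<\infty$. The training set $\mathcal{D}_n=((X_1,Y_1),\dots,(X_n,Y_n))$ consists of i.i.d. copies of $(X,Y)$, independent of $(X,Y)$. The excess risk of an estimator $f_n$ is $\mathcal{R}(f_n)=\mathbb{E}[(f_n(X)-f^\star(X))^2]$; $f_n$ is consistent if $\mathcal{R}(f_n)\to0$ as $n\to\infty$ and inconsistent otherwise. Centered tree of depth $k$: starting from the root cell $[0,1]^d$, for $k$ successive levels every cell is split at the middle of its side along a coordinate direction chosen uniformly at random in $\{1,\dots,d\}$ (choices independent across cells and independent of the data; $\Theta$ denotes all these random choices). This gives $2^k$ leaves, each of volume $2^{-k}$. Let $A_n(x,\Theta)$ be the leaf containing $x$ and $N_n(x,\Theta)$ the number of $X_i$'s in it. The tree prediction is $f_n(x,\Theta)=\sum_{i=1}^n\frac{\mathbf{1}_{X_i\in A_n(x,\Theta)}Y_i}{N_n(x,\Theta)}\mathbf{1}_{N_n(x,\Theta)>0}$ (equal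 to $0$ on empty leaves), and the infinite centered random forest is $f^{\mathrm{CRF}}_{\infty,n}(x)=\mathbb{E}_\Theta[f_n(x,\Theta)]$, the expectation being over $\Theta$ conditionally on $\mathcal{D}_n$. *)

theory Defs
  imports "HOL-Probability.Probability"
begin

section \<open>Regression setting\<close>

definition gen_by :: "'a measure \<Rightarrow> ('a \<Rightarrow> 'b::topological_space) \<Rightarrow> 'a measure" where
  "gen_by M X = vimage_algebra (space M) X borel"

text \<open>
  Conditional variance given a sub-sigma-algebra. The outer conditional expectation takes values in
  the extended nonnegative reals, so that an infinite conditional second moment is not turned into
  \<open>0\<close>, as it would be by \<^const>\<open>real_cond_exp\<close>.
\<close>
definition cond_variance :: "'a measure \<Rightarrow> 'a measure \<Rightarrow> ('a \<Rightarrow> real) \<Rightarrow> 'a \<Rightarrow> ennreal" where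
  "cond_variance M F Z =
     nn_cond_exp M F (\<lambda>\<omega>. ennreal ((Z \<omega> - real_cond_exp M F Z \<omega>)\<^sup>2))"

text \<open>
  The training set of size \<open>n\<close> consists of the pairs with index \<open>i < n\<close> of a sequence of copies of
  \<open>(X, Y)\<close>. The assumption \<open>regression_function\<close> says that \<open>fstar\<close> is a version of
  \<open>x \<mapsto> E[Y | X = x]\<close>. The assumption \<open>sample_indep\<close> is mutual independence of \<open>(X, Y)\<close> and all the
  copies, that is, the copies are independent and (jointly) independent of \<open>(X, Y)\<close>. Square integrability of \<open>fstar(X)\<close> is not assumed.
\<close>
locale regression_setting = prob_space M
  for M :: "'a measure" +
  fixes X :: "'a \<Rightarrow> real ^ 'd" and Y eps :: "'a \<Rightarrow> real"
    and fstar :: "real ^ 'd \<Rightarrow> real" and \<sigma> :: real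
    and Xs :: "nat \<Rightarrow> 'a \<Rightarrow> real ^ 'd" and Ys :: "nat \<Rightarrow> 'a \<Rightarrow> real"
  assumes X_measurable: "X \<in> borel_measurable M"
    and X_uniform: "distr M borel X = uniform_measure lborel (cbox 0 1)"
    and Y_integrable: "integrable M Y"
    and fstar_measurable: "fstar \<in> borel_measurable borel"
    and regression_function: "AE \<omega> in M. real_cond_exp M (gen_by M X) Y \<omega> = fstar (X \<omega>)"
    and Y_eq: "\<And>\<omega>. \<omega> \<in> space M \<Longrightarrow> Y \<omega> = fstar (X \<omega>) + eps \<omega>"
    and noise_centered: "AE \<omega> in M. real_cond_exp M (gen_by M X) eps \<omega> = 0"
    and noise_variance: "AE \<omega> in M. cond_variance M (gen_by M X) eps \<omega> \<le> ennreal (\<sigma>\<^sup>2)"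
    and sample_indep:
      "indep_vars (\<lambda>_. borel \<Otimes>\<^sub>M borel)
         (case_nat (\<lambda>\<omega>. (X \<omega>, Y \<omega>)) (\<lambda>i \<omega>. (Xs i \<omega>, Ys i \<omega>))) UNIV"
    and sample_copies:
      "\<And>i. distr M (borel \<Otimes>\<^sub>M borel) (\<lambda>\<omega>. (Xs i \<omega>, Ys i \<omega>)) =
            distr M (borel \<Otimes>\<^sub>M borel) (\<lambda>\<omega>. (X \<omega>, Y \<omega>))"

text \<open>
  Excess risk of a (data-dependent, hence random) estimator. It may be infinite, which is why it is
  a nonnegative Lebesgue integral.
\<close>
definition excess_risk ::
    "'a measure \<Rightarrow> ('a \<Rightarrow> 'b) \<Rightarrow> ('b \<Rightarrow> real) \<Rightarrow> ('a \<Rightarrow> 'b \<Rightarrow> real) \<Rightarrow> ennreal" where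
  "excess_risk M X fstar f = (\<integral>\<^sup>+ \<omega>. ennreal ((f \<omega> (X \<omega>) - fstar (X \<omega>))\<^sup>2) \<partial>M)"

definition consistent ::
    "'a measure \<Rightarrow> ('a \<Rightarrow> 'b) \<Rightarrow> ('b \<Rightarrow> real) \<Rightarrow> (nat \<Rightarrow> 'a \<Rightarrow> 'b \<Rightarrow> real) \<Rightarrow> bool" where
  "consistent M X fstar f \<longleftrightarrow> (\<lambda>n. excess_risk M X fstar (f n)) \<longlonglongrightarrow> 0"


section \<open>Centered trees and the infinite centered random forest\<close>

text \<open>
  The nodes of the tree are addressed by bit lists, the most recent choice first: the children of
  \<open>p\<close> are \<open>False # p\<close> (lower half) and \<open>True # p\<close> (upper half), and \<open>\<theta> p\<close> is the direction along
  which the cell at \<open>p\<close> is split. \<open>corners \<theta> p\<close> are the lower and the upper corner of that cell.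
\<close>
primrec corners :: "(bool list \<Rightarrow> 'd::finite) \<Rightarrow> bool list \<Rightarrow> (real ^ 'd) \<times> (real ^ 'd)" where
  "corners \<theta> [] = (0, 1)"
| "corners \<theta> (b # p) =
     (let (l, u) = corners \<theta> p; j = \<theta> p; m = (l $ j + u $ j) / 2
      in if b then (\<chi> i. if i = j then m else l $ i, u)
         else (l, \<chi> i. if i = j then m else u $ i))"

definition split_point :: "(bool list \<Rightarrow> 'd::finite) \<Rightarrow> bool list \<Rightarrow> real" where
  "split_point \<theta> p = (fst (corners \<theta> p) $ \<theta> p + snd (corners \<theta> p) $ \<theta> p) / 2"

text \<open>
  Points on a splitting hyperplane are put in the upper half, so that the cells of a given depth
  partition \<open>[0,1]\<^sup>d\<close>.
\<close>
primrec cell :: "(bool list \<Rightarrow> 'd::finite) \<Rightarrow> bool list \<Rightarrow> (real ^ 'd) set" where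
  "cell \<theta> [] = cbox 0 1"
| "cell \<theta> (b # p) =
     {x \<in> cell \<theta> p. if b then split_point \<theta> p \<le> x $ \<theta> p else x $ \<theta> p < split_point \<theta> p}"

definition leaves :: "(bool list \<Rightarrow> 'd::finite) \<Rightarrow> nat \<Rightarrow> (real ^ 'd) set set" where
  "leaves \<theta> k = {cell \<theta> p | p. length p = k}"

text \<open>
  The leaf containing \<open>x\<close>: the union has exactly one member if \<open>x\<close> lies in \<open>[0,1]\<^sup>d\<close>, and it is empty
  otherwise.
\<close>
definition leaf_of :: "(bool list \<Rightarrow> 'd::finite) \<Rightarrow> nat \<Rightarrow> real ^ 'd \<Rightarrow> (real ^ 'd) set" where
  "leaf_of \<theta> k x = \<Union>{A \<in> leaves \<theta> k. x \<in> A}"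

lemma ex1_leaf:
  assumes "x \<in> cbox 0 1"
  shows "\<exists>!p. length p = k \<and> x \<in> cell \<theta> p"
proof (induction k)
  case 0
  show ?case using assms by (auto intro!: ex1I[of _ "[]"])
next
  case (Suc k)
  then obtain p where p: "length p = k" "x \<in> cell \<theta> p"
    and uniq: "\<And>q. length q = k \<Longrightarrow> x \<in> cell \<theta> q \<Longrightarrow> q = p" by blast
  let ?b = "split_point \<theta> p \<le> x $ \<theta> p"
  show ?case
  proof (rule ex1I[of _ "?b # p"])
    show "length (?b # p) = Suc k \<and> x \<in> cell \<theta> (?b # p)" using p by auto
  next
    fix q assume q: "length q = Suc k \<and> x \<in> cell \<theta> q"
    then obtain c r where qr: "q = c # r" "length r = k" by (cases q) auto
    with q have "x \<in> cell \<theta> r" by simp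
    with uniq qr have "r = p" by blast
    with q qr show "q = ?b # p" by (auto split: if_splits)
  qed
qed

lemma leaf_of_eq_cell:
  assumes "length p = k" "x \<in> cell \<theta> p"
  shows "leaf_of \<theta> k x = cell \<theta> p"
proof -
  have sub: "cell \<theta> q \<subseteq> cbox 0 1" for q by (induction q) auto
  have "q = p" if "length q = k" "x \<in> cell \<theta> q" for q
    using that assms ex1_leaf[of x k \<theta>] sub[of p] by blast
  then have "{A \<in> leaves \<theta> k. x \<in> A} = {cell \<theta> p}"
    using assms unfolding leaves_def by blast
  then show ?thesis by (simp add: leaf_of_def)
qed

text \<open>
  Law of the randomness of a tree of depth \<open>k\<close>: independent uniform directions for all the cells of
  depth less than \<open>k\<close>.
\<close>
definition centered_splits :: "nat \<Rightarrow> (bool list \<Rightarrow> 'd::finite) pmf" where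
  "centered_splits k = Pi_pmf {p. length p < k} undefined (\<lambda>_. pmf_of_set UNIV)"

definition leaf_count ::
    "(bool list \<Rightarrow> 'd::finite) \<Rightarrow> nat \<Rightarrow> nat \<Rightarrow> (nat \<Rightarrow> real ^ 'd) \<Rightarrow> real ^ 'd \<Rightarrow> nat" where
  "leaf_count \<theta> k n xs x = card {i \<in> {..<n}. xs i \<in> leaf_of \<theta> k x}"

definition tree_prediction ::
    "(bool list \<Rightarrow> 'd::finite) \<Rightarrow> nat \<Rightarrow> nat \<Rightarrow> (nat \<Rightarrow> real ^ 'd) \<Rightarrow> (nat \<Rightarrow> real) \<Rightarrow> real ^ 'd \<Rightarrow> real" where
  "tree_prediction \<theta> k n xs ys x =
     (\<Sum>i<n. indicator (leaf_of \<theta> k x) (xs i) * ys i / real (leaf_count \<theta> k n xs x)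
              * of_bool (leaf_count \<theta> k n xs x > 0))"

text \<open>
  As the splits are independent of the data, the expectation over them conditionally on the data is
  the expectation under their law with the data \<open>xs\<close>, \<open>ys\<close> held fixed.
\<close>
definition infinite_crf ::
    "nat \<Rightarrow> nat \<Rightarrow> (nat \<Rightarrow> real ^ 'd::finite) \<Rightarrow> (nat \<Rightarrow> real) \<Rightarrow> real ^ 'd \<Rightarrow> real" where
  "infinite_crf k n xs ys x =
     measure_pmf.expectation (centered_splits k) (\<lambda>\<theta>. tree_prediction \<theta> k n xs ys x)"

end

theory Submission
  imports Defs
begin

text \<open>
  Write \<open>p = 2\<^sup>-\<^sup>k\<close> and let \<open>s\<close> be the sign of \<open>f = fstar\<close>. Expanding the tree over its leaves \<open>L\<close> and
  over the random set \<open>S\<close> of sample points that fall in \<open>L\<close>, independence factorizes the correlation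
  of the prediction with \<open>s(X)\<close>. Each leaf contributes at most
  \<open>(1 - (1 - p)\<^sup>n) E[\<bar>f(X)\<bar>; X \<in> L]\<close>, because only nonempty \<open>S\<close> count and \<open>P(L is empty) = (1 - p)\<^sup>n\<close>.
  Hence \<open>E[s(X) f\<^sub>n(X)] \<le> (1 - (1 - p)\<^sup>n) E\<bar>f(X)\<bar>\<close> for every tree, thus for the forest, and
  so \<open>E\<bar>f\<^sub>n(X) - f(X)\<bar> \<ge> (1 - p)\<^sup>n E\<bar>f(X)\<bar>\<close>. If \<open>p \<le> 1/(\<alpha> n)\<close>, the right-hand side stays away
  from \<open>0\<close>. Working in \<open>L\<^sup>1\<close> also covers an \<open>f\<close> that is not square integrable.
\<close>

section \<open>Cells\<close>

lemma corners_less: "fst (corners \<theta> p) $ i < snd (corners \<theta> p) $ i"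
proof (induction p arbitrary: i)
  case (Cons b p)
  then show ?case
    using Cons[of "\<theta> p"] by (cases "corners \<theta> p") (auto simp: Let_def)
qed simp

text \<open>A cell is half-open in some directions, so it is not a library box. It is sandwiched
  between the open and the closed box with its corners; the volume needs only these two
  inclusions.\<close>

lemma box_subset_cell: "box (fst (corners \<theta> p)) (snd (corners \<theta> p)) \<subseteq> cell \<theta> p"
proof (induction p)
  case Nil
  show ?case using box_subset_cbox by auto
next
  case (Cons b p)
  obtain l u where lu: "corners \<theta> p = (l, u)" by (cases "corners \<theta> p")
  have lt: "l $ \<theta> p < u $ \<theta> p" using corners_less[of \<theta> p "\<theta> p"] lu by simp
  show ?case
  proof
    fix x assume x: "x \<in> box (fst (corners \<theta> (b # p))) (snd (corners \<theta> (b # p)))"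
    have "x \<in> box l u"
      unfolding mem_box_cart
    proof
      fix i
      show "l $ i < x $ i \<and> x $ i < u $ i"
        using x lu lt by (cases b; cases "i = \<theta> p") (auto simp: mem_box_cart Let_def dest!: spec[of _ i])
    qed
    then have "x \<in> cell \<theta> p" using Cons lu by auto
    moreover have "if b then split_point \<theta> p \<le> x $ \<theta> p else x $ \<theta> p < split_point \<theta> p"
      using x lu by (auto simp: mem_box_cart Let_def split_point_def dest!: spec[of _ "\<theta> p"])
    ultimately show "x \<in> cell \<theta> (b # p)" by simp
  qed
qed

lemma cell_subset_cbox: "cell \<theta> p \<subseteq> cbox (fst (corners \<theta> p)) (snd (corners \<theta> p))"
proof (induction p)
  case (Cons b p)
  then show ?case
    by (cases "corners \<theta> p") (fastforce simp: mem_box_cart Let_def split_point_def)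
qed simp

lemma prod_corners:
  "(\<Prod>i\<in>UNIV. snd (corners \<theta> p) $ i - fst (corners \<theta> p) $ i) = (1/2) ^ length p"
proof (induction p)
  case (Cons b p)
  obtain l u where lu: "corners \<theta> p = (l, u)" by (cases "corners \<theta> p")
  have "(\<Prod>i\<in>UNIV. snd (corners \<theta> (b # p)) $ i - fst (corners \<theta> (b # p)) $ i)
    = (\<Prod>i\<in>UNIV. (u $ i - l $ i) * (if i = \<theta> p then 1/2 else 1))"
    using lu by (intro prod.cong) (auto simp: Let_def field_simps)
  also have "\<dots> = (1/2) ^ length p * (1/2)"
    using Cons lu by (simp add: prod.distrib)
  finally show ?case by simp
qed simp

lemma cell_borel [measurable]: "cell \<theta> p \<in> sets borel"
proof (induction p)
  case (Cons b p)
  note Cons [measurable]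
  show ?case by (cases b) auto
qed simp

text \<open>The open and the closed box of the sandwich have the same volume, which is the product
  of the side lengths.\<close>

lemma measure_cell: "measure lborel (cell \<theta> p) = (1/2) ^ length p"
proof -
  let ?l = "fst (corners \<theta> p)" and ?u = "snd (corners \<theta> p)"
  have le: "?l \<bullet> b \<le> ?u \<bullet> b" if "b \<in> Basis" for b
    using that corners_less[of \<theta> p] by (auto simp: Basis_vec_def inner_axis intro: less_imp_le)
  have fm: "cbox ?l ?u \<in> fmeasurable lborel" "cell \<theta> p \<in> fmeasurable lborel"
    using cell_subset_cbox[of \<theta> p] by (auto intro: fmeasurableI2[of "cbox ?l ?u"])
  have "?l \<in> cbox ?l ?u" using le by (simp add: mem_box)
  then have vol: "measure lborel (cbox ?l ?u) = (1/2) ^ length p"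
    using prod_corners[of \<theta> p] by (subst content_cbox_cart) auto
  have "measure lborel (box ?l ?u) \<le> measure lborel (cell \<theta> p)"
    using box_subset_cell fm(2) by (intro measure_mono_fmeasurable) auto
  moreover have "measure lborel (cell \<theta> p) \<le> measure lborel (cbox ?l ?u)"
    using cell_subset_cbox fm by (intro measure_mono_fmeasurable) auto
  moreover have "measure lborel (box ?l ?u) = measure lborel (cbox ?l ?u)"
    using le by (simp add: measure_lborel_box_eq measure_lborel_cbox_eq)
  ultimately show ?thesis using vol by simp
qed

section \<open>Cells of one depth taken together\<close>

lemma cell_subset_root: "cell \<theta> p \<subseteq> cbox 0 1"
  by (induction p) auto

lemma finite_bool_lists: "finite {p :: bool list. length p = k}"
  using finite_lists_length_eq[of "UNIV :: bool set" k] by simp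

text \<open>The sum is 1 on the cube and 0 outside it. As an inequality the bound is valid at every
  point, so no null set has to be removed when \<open>X \<omega>\<close> is substituted.\<close>

lemma sum_indicator_cell_le: "(\<Sum>p | length p = k. indicator (cell \<theta> p) x) \<le> (1::real)"
proof (cases "x \<in> cbox 0 1")
  case True
  then obtain p where p: "length p = k" "x \<in> cell \<theta> p"
    and iff: "\<And>q. length q = k \<Longrightarrow> x \<in> cell \<theta> q \<longleftrightarrow> q = p"
    using ex1_leaf[of x k \<theta>] by blast
  have "(\<Sum>q | length q = k. indicator (cell \<theta> q) x) = (\<Sum>q | length q = k. if q = p then 1 else 0 :: real)"
    by (intro sum.cong) (auto simp: indicator_def iff)
  then show ?thesis using finite_bool_lists[of k] by simp
next
  case False
  then have "x \<notin> cell \<theta> p" for p using cell_subset_root by blast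
  then show ?thesis by (simp add: indicator_def)
qed


section \<open>Expansion of a tree prediction over the occupation pattern of the leaf\<close>

text \<open>For \<open>S \<subseteq> {..<n}\<close> this is the indicator of the event that
  \<open>S\<close> is exactly the set of indices of sample points in \<open>L\<close>. The product
  form, with one factor per sample point, is what independence can factorize.\<close>

definition hit_pattern :: "'b set \<Rightarrow> nat set \<Rightarrow> nat \<Rightarrow> (nat \<Rightarrow> 'b) \<Rightarrow> real" where
  "hit_pattern L S n xs = (\<Prod>j<n. if j \<in> S then indicator L (xs j) else 1 - indicator L (xs j))"

lemma hit_pattern_eq:
  assumes "S \<subseteq> {..<n}"
  shows "hit_pattern L S n xs = of_bool (S = {j. j < n \<and> xs j \<in> L})"
proof (cases "S = {j. j < n \<and> xs j \<in> L}")
  case True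
  then show ?thesis unfolding hit_pattern_def by (auto intro!: prod.neutral)
next
  case False
  then obtain j where "j < n" "j \<in> S \<longleftrightarrow> xs j \<notin> L" using assms by auto
  then have "\<exists>j\<in>{..<n}. (if j \<in> S then indicator L (xs j) else 1 - indicator L (xs j)) = (0::real)"
    by (intro bexI[of _ j]) auto
  then have "hit_pattern L S n xs = 0"
    unfolding hit_pattern_def by (intro prod_zero) auto
  with False show ?thesis by simp
qed

text \<open>Summing over all possible patterns \<open>S\<close> turns the random denominator
  \<open>N\<close> into the constant \<open>card S\<close>; only the pattern that occurs survives.
  The empty pattern contributes an empty sum, which matches the value 0 on empty leaves.\<close>

lemma local_average_eq:
  fixes n :: nat and xs :: "nat \<Rightarrow> 'b" and ys :: "nat \<Rightarrow> real" and L :: "'b set"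
  defines "N \<equiv> card {i \<in> {..<n}. xs i \<in> L}"
  shows "(\<Sum>i<n. indicator L (xs i) * ys i / real (N) * of_bool (N > 0))
    = (\<Sum>S\<in>Pow {..<n}. \<Sum>i\<in>S. ys i / card S * hit_pattern L S n xs)"
proof -
  let ?T = "{j. j < n \<and> xs j \<in> L}"
  have N: "N = card ?T" unfolding N_def by (auto intro: arg_cong[where f=card])
  have "(\<Sum>i<n. indicator L (xs i) * ys i / real (N) * of_bool (N > 0))
    = (\<Sum>i<n. if i \<in> ?T then ys i / card ?T else 0)"
    unfolding N by (intro sum.cong) (auto simp: card_gt_0_iff indicator_def)
  also have "\<dots> = (\<Sum>i\<in>?T. ys i / card ?T)"
    by (subst sum.inter_restrict[symmetric]) (auto intro!: sum.cong)
  also have "\<dots> = (\<Sum>S\<in>Pow {..<n}. if S = ?T then (\<Sum>i\<in>S. ys i / card S) else 0)"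
    by (subst sum.delta) auto
  also have "\<dots> = (\<Sum>S\<in>Pow {..<n}. \<Sum>i\<in>S. ys i / card S * hit_pattern L S n xs)"
    by (intro sum.cong refl) (auto simp: hit_pattern_eq)
  finally show ?thesis .
qed

text \<open>Replaces the leaf that depends on \<open>x\<close> by a sum over fixed cells: exactly
  one of them contains \<open>x\<close> if \<open>x\<close> is in the cube, and both sides vanish
  otherwise.\<close>

lemma tree_prediction_eq:
  "tree_prediction \<theta> k n xs ys x =
    (\<Sum>p | length p = k. \<Sum>S\<in>Pow {..<n}. \<Sum>i\<in>S.
       indicator (cell \<theta> p) x * (ys i / card S * hit_pattern (cell \<theta> p) S n xs))"
proof (cases "x \<in> cbox 0 1")
  case True
  then obtain p where p: "length p = k" "x \<in> cell \<theta> p"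
    and iff: "\<And>q. length q = k \<Longrightarrow> x \<in> cell \<theta> q \<longleftrightarrow> q = p"
    using ex1_leaf[of x k \<theta>] by blast
  let ?h = "\<lambda>q. \<Sum>S\<in>Pow {..<n}. \<Sum>i\<in>S. ys i / card S * hit_pattern (cell \<theta> q) S n xs"
  have "tree_prediction \<theta> k n xs ys x = ?h p"
    unfolding tree_prediction_def leaf_count_def leaf_of_eq_cell[OF p] by (rule local_average_eq)
  also have "\<dots> = (\<Sum>q | length q = k. if q = p then ?h q else 0)"
    using finite_bool_lists[of k] p by simp
  also have "\<dots> = (\<Sum>q | length q = k. indicator (cell \<theta> q) x * ?h q)"
    by (intro sum.cong refl) (simp add: indicator_def iff)
  finally show ?thesis by (simp add: sum_distrib_left)
next
  case False
  then have "x \<notin> cell \<theta> p" for p using cell_subset_root by blast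
  moreover from this have "leaf_of \<theta> k x = {}" by (auto simp: leaf_of_def leaves_def)
  ultimately show ?thesis by (simp add: tree_prediction_def)
qed

text \<open>Only finitely many addresses are split and there are finitely many directions, so the
  forest is a finite convex combination of trees and no exchange of integrals is needed
  later.\<close>

lemma infinite_crf_eq:
  fixes xs :: "nat \<Rightarrow> real ^ 'd::finite"
  shows "infinite_crf k n xs ys x =
    (\<Sum>\<theta>\<in>set_pmf (centered_splits k). tree_prediction \<theta> k n xs ys x * pmf (centered_splits k) \<theta>)"
  and finite_set_centered_splits: "finite (set_pmf (centered_splits k :: (bool list \<Rightarrow> 'd) pmf))"
proof -
  have "finite {p :: bool list. length p < k}"
    by (rule finite_subset[OF _ finite_lists_length_le[of "UNIV :: bool set" k]]) auto
  then show fin: "finite (set_pmf (centered_splits k :: (bool list \<Rightarrow> 'd) pmf))"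
    by (simp add: centered_splits_def set_Pi_pmf finite_PiE_dflt)
  show "infinite_crf k n xs ys x =
    (\<Sum>\<theta>\<in>set_pmf (centered_splits k). tree_prediction \<theta> k n xs ys x * pmf (centered_splits k) \<theta>)"
    unfolding infinite_crf_def by (rule integral_measure_pmf_real) (use fin in auto)
qed

text \<open>With \<open>q\<close> the probability that a sample point misses the leaf, this is the
  probability that the leaf is not empty: expand the product of \<open>(1 - q) + q\<close> over
  subsets and remove the term \<open>q ^ n\<close> of the empty set.\<close>

lemma sum_occupation:
  fixes q :: real
  shows "(\<Sum>S\<in>Pow {..<n} - {{}}. \<Prod>j<n. if j \<in> S then 1 - q else q) = 1 - q ^ n"
proof -
  have "(\<Prod>j<n. if j \<in> S then 1 - q else q) = (\<Prod>j\<in>S. 1 - q) * (\<Prod>j\<in>{..<n} - S. q)"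
    if "S \<in> Pow {..<n}" for S
  proof -
    have "{..<n} \<inter> S = S" "{..<n} \<inter> - S = {..<n} - S" using that by auto
    then show ?thesis by (simp add: prod.If_cases)
  qed
  then have "(\<Sum>S\<in>Pow {..<n}. \<Prod>j<n. if j \<in> S then 1 - q else q) = (\<Prod>j<n. (1 - q) + q)"
    by (subst prod_add) auto
  then show ?thesis by (simp add: sum_diff1)
qed


section \<open>The estimator correlates too little with the sign of the regression function\<close>

context regression_setting
begin

section \<open>Measurability, cell probabilities and conditional expectations\<close>

declare X_measurable [measurable] fstar_measurable [measurable]

lemma Y_measurable [measurable]: "Y \<in> borel_measurable M"
  using Y_integrable by auto

lemma sample_pair_measurable:
  "(\<lambda>\<omega>. (Xs i \<omega>, Ys i \<omega>)) \<in> measurable M (borel \<Otimes>\<^sub>M borel)"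
proof -
  have "\<forall>i\<in>UNIV. random_variable (borel \<Otimes>\<^sub>M borel)
      (case_nat (\<lambda>\<omega>. (X \<omega>, Y \<omega>)) (\<lambda>i \<omega>. (Xs i \<omega>, Ys i \<omega>)) i)"
    using sample_indep unfolding indep_vars_def by simp
  from this[rule_format, of "Suc i"] show ?thesis by simp
qed

lemma Xs_measurable [measurable]: "Xs i \<in> borel_measurable M"
  and Ys_measurable [measurable]: "Ys i \<in> borel_measurable M"
  using measurable_compose[OF sample_pair_measurable[of i] measurable_fst]
    measurable_compose[OF sample_pair_measurable[of i] measurable_snd] by simp_all

lemma expectation_cell:
  "expectation (\<lambda>\<omega>. indicator (cell \<theta> p) (X \<omega>)) = ((1/2) ^ length p :: real)"
proof -
  have "expectation (\<lambda>\<omega>. indicator (cell \<theta> p) (X \<omega>))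
      = integral\<^sup>L (distr M borel X) (indicator (cell \<theta> p) :: _ \<Rightarrow> real)"
    by (rule integral_distr[symmetric]) auto
  also have "\<dots> = measure (uniform_measure lborel (cbox 0 1)) (cell \<theta> p)"
    unfolding X_uniform by simp
  also have "\<dots> = (1/2) ^ length p"
  proof -
    have "measure lborel (cbox 0 1 :: (real ^ 'd) set) = 1"
      using measure_cell[of "undefined :: _ \<Rightarrow> 'd" "[]"] by simp
    moreover have "emeasure lborel (cbox 0 1 :: (real ^ 'd) set) \<noteq> 0"
      using calculation by (auto simp: measure_def)
    moreover have "cbox 0 1 \<inter> cell \<theta> p = cell \<theta> p" using cell_subset_root by blast
    ultimately show ?thesis
      by (subst measure_uniform_measure) (auto simp: measure_cell emeasure_lborel_cbox_eq)
  qed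
  finally show ?thesis .
qed

lemma sigma_finite_gen_by: "sigma_finite_subalgebra M (gen_by M X)"
  by (intro finite_measure_subalgebra_is_sigma_finite finite_measure_subalgebra.intro
      finite_measure_subalgebra_axioms.intro finite_measure_axioms)
    (auto simp: subalgebra_def gen_by_def sets_vimage_algebra2 intro: measurable_sets)

text \<open>Inherited from \<open>Y\<close>: \<open>fstar (X \<omega>)\<close> is almost surely its
  conditional expectation.\<close>

lemma fstar_integrable: "integrable M (\<lambda>\<omega>. fstar (X \<omega>))"
proof -
  interpret sigma_finite_subalgebra M "gen_by M X" by (rule sigma_finite_gen_by)
  show ?thesis
    by (rule Bochner_Integration.integrable_cong_AE_imp[OF real_cond_exp_int(1)[OF Y_integrable]])
      (use regression_function in \<open>auto elim!: eventually_mono\<close>)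
qed

text \<open>The defining property of conditional expectation, tested against the indicator of an
  event generated by \<open>X\<close>.\<close>

lemma expectation_Y_cell:
  "expectation (\<lambda>\<omega>. Y \<omega> * indicator (cell \<theta> p) (X \<omega>))
    = expectation (\<lambda>\<omega>. fstar (X \<omega>) * indicator (cell \<theta> p) (X \<omega>))"
proof -
  interpret sigma_finite_subalgebra M "gen_by M X" by (rule sigma_finite_gen_by)
  have X: "X \<in> borel_measurable (gen_by M X)"
    unfolding gen_by_def by (rule measurable_vimage_algebra1) simp
  have [measurable]: "(\<lambda>\<omega>. indicator (cell \<theta> p) (X \<omega>) :: real) \<in> borel_measurable (gen_by M X)"
    using measurable_compose[OF X, of "indicator (cell \<theta> p) :: _ \<Rightarrow> real" borel] by simp
  have "integrable M (\<lambda>\<omega>. indicator (cell \<theta> p) (X \<omega>) * Y \<omega>)"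
    by (rule Bochner_Integration.integrable_bound[OF Y_integrable]) (auto simp: indicator_def)
  then have "expectation (\<lambda>\<omega>. indicator (cell \<theta> p) (X \<omega>) * real_cond_exp M (gen_by M X) Y \<omega>)
      = expectation (\<lambda>\<omega>. indicator (cell \<theta> p) (X \<omega>) * Y \<omega>)"
    by (rule real_cond_exp_intg(2)) auto
  moreover have "expectation (\<lambda>\<omega>. indicator (cell \<theta> p) (X \<omega>) * real_cond_exp M (gen_by M X) Y \<omega>)
      = expectation (\<lambda>\<omega>. indicator (cell \<theta> p) (X \<omega>) * fstar (X \<omega>))"
    by (rule integral_cong_AE) (use regression_function in \<open>auto elim!: eventually_mono\<close>)
  ultimately show ?thesis by (simp add: mult.commute)
qed

section \<open>Independence and identical distribution of the sample\<close>

lemma expectation_copy: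
  fixes \<phi> :: "(real ^ 'd) \<times> real \<Rightarrow> real"
  assumes [measurable]: "\<phi> \<in> borel_measurable (borel \<Otimes>\<^sub>M borel)"
  shows "expectation (\<lambda>\<omega>. \<phi> (Xs i \<omega>, Ys i \<omega>)) = expectation (\<lambda>\<omega>. \<phi> (X \<omega>, Y \<omega>))"
    and "integrable M (\<lambda>\<omega>. \<phi> (Xs i \<omega>, Ys i \<omega>)) \<longleftrightarrow> integrable M (\<lambda>\<omega>. \<phi> (X \<omega>, Y \<omega>))"
proof -
  have XY: "(\<lambda>\<omega>. (X \<omega>, Y \<omega>)) \<in> measurable M (borel \<Otimes>\<^sub>M borel)" by measurable
  show "expectation (\<lambda>\<omega>. \<phi> (Xs i \<omega>, Ys i \<omega>)) = expectation (\<lambda>\<omega>. \<phi> (X \<omega>, Y \<omega>))"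
    using integral_distr[OF sample_pair_measurable assms, of i] integral_distr[OF XY assms]
    by (simp add: sample_copies)
  show "integrable M (\<lambda>\<omega>. \<phi> (Xs i \<omega>, Ys i \<omega>)) \<longleftrightarrow> integrable M (\<lambda>\<omega>. \<phi> (X \<omega>, Y \<omega>))"
    using integrable_distr_eq[OF sample_pair_measurable assms, of i] integrable_distr_eq[OF XY assms]
    by (simp add: sample_copies)
qed

lemma expectation_prod_sample:
  fixes \<psi> :: "(real ^ 'd) \<times> real \<Rightarrow> real" and \<phi> :: "nat \<Rightarrow> (real ^ 'd) \<times> real \<Rightarrow> real"
  assumes [measurable]: "\<psi> \<in> borel_measurable (borel \<Otimes>\<^sub>M borel)"
      "\<And>i. \<phi> i \<in> borel_measurable (borel \<Otimes>\<^sub>M borel)"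
    and "integrable M (\<lambda>\<omega>. \<psi> (X \<omega>, Y \<omega>))" "\<And>i. integrable M (\<lambda>\<omega>. \<phi> i (X \<omega>, Y \<omega>))"
  shows "expectation (\<lambda>\<omega>. \<psi> (X \<omega>, Y \<omega>) * (\<Prod>i<n. \<phi> i (Xs i \<omega>, Ys i \<omega>)))
      = expectation (\<lambda>\<omega>. \<psi> (X \<omega>, Y \<omega>)) * (\<Prod>i<n. expectation (\<lambda>\<omega>. \<phi> i (X \<omega>, Y \<omega>)))" (is ?eq)
    and "integrable M (\<lambda>\<omega>. \<psi> (X \<omega>, Y \<omega>) * (\<Prod>i<n. \<phi> i (Xs i \<omega>, Ys i \<omega>)))" (is ?int)
proof -
  \<comment> \<open>Index 0 is the test pair and index \<open>Suc j\<close> is sample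
    \<open>j\<close>, so one independent family covers both.\<close>
  define W where "W i = (\<lambda>\<omega>. case i of 0 \<Rightarrow> \<psi> (X \<omega>, Y \<omega>) | Suc j \<Rightarrow> \<phi> j (Xs j \<omega>, Ys j \<omega>))" for i
  have "indep_vars (\<lambda>_. borel)
      (\<lambda>i \<omega>. case_nat \<psi> \<phi> i (case_nat (\<lambda>\<omega>. (X \<omega>, Y \<omega>)) (\<lambda>i \<omega>. (Xs i \<omega>, Ys i \<omega>)) i \<omega>)) UNIV"
    by (rule indep_vars_compose2[OF sample_indep]) (auto split: nat.split)
  also have "(\<lambda>i \<omega>. case_nat \<psi> \<phi> i (case_nat (\<lambda>\<omega>. (X \<omega>, Y \<omega>)) (\<lambda>i \<omega>. (Xs i \<omega>, Ys i \<omega>)) i \<omega>)) = W"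
    by (auto simp: W_def fun_eq_iff split: nat.split)
  finally have ind: "indep_vars (\<lambda>_. borel) W {..<Suc n}"
    by (rule indep_vars_subset) simp
  have int: "integrable M (W i)" for i
    using assms(3,4) by (cases i) (simp_all add: W_def expectation_copy(2))
  have prod: "(\<Prod>i<Suc n. W i \<omega>) = \<psi> (X \<omega>, Y \<omega>) * (\<Prod>i<n. \<phi> i (Xs i \<omega>, Ys i \<omega>))" for \<omega>
    by (simp add: prod.lessThan_Suc_shift W_def del: prod.lessThan_Suc)
  have "expectation (\<lambda>\<omega>. \<Prod>i<Suc n. W i \<omega>) = (\<Prod>i<Suc n. expectation (W i))"
    using indep_vars_lebesgue_integral[OF _ ind int] by simp
  also have "\<dots> = expectation (\<lambda>\<omega>. \<psi> (X \<omega>, Y \<omega>)) * (\<Prod>i<n. expectation (\<lambda>\<omega>. \<phi> i (X \<omega>, Y \<omega>)))"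
    by (simp add: prod.lessThan_Suc_shift W_def expectation_copy(1) del: prod.lessThan_Suc)
  finally show ?eq unfolding prod .
  show ?int using indep_vars_integrable[OF _ ind int] unfolding prod by simp
qed

text \<open>Independence splits the expectation into three parts: \<open>s (X \<omega>)\<close> on
  the cell, \<open>Y\<close> on the cell for index \<open>i\<close>, and the pattern factors of all
  other indices. The first is at most the cell probability \<open>1 - q\<close>, which is just the
  pattern factor missing at \<open>i\<close>; the second is at most the integral of
  \<open>\<bar>fstar\<bar>\<close> over the cell. The test point and sample \<open>i\<close> thus
  exchange roles.\<close>

lemma expectation_hit_pattern:
  fixes \<theta> :: "bool list \<Rightarrow> 'd" and p :: "bool list" and s :: "real ^ 'd \<Rightarrow> real"
  assumes s [measurable]: "s \<in> borel_measurable borel" and s_le: "\<And>x. \<bar>s x\<bar> \<le> 1"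
    and i: "i \<in> S" and S: "S \<subseteq> {..<n}"
  defines "Z \<equiv> \<lambda>\<omega>. s (X \<omega>) * indicator (cell \<theta> p) (X \<omega>)
      * (Ys i \<omega> * hit_pattern (cell \<theta> p) S n (\<lambda>j. Xs j \<omega>))"
    and "q \<equiv> 1 - (1/2) ^ length p"
  shows "integrable M Z"
    and "expectation Z \<le> expectation (\<lambda>\<omega>. \<bar>fstar (X \<omega>)\<bar> * indicator (cell \<theta> p) (X \<omega>))
      * (\<Prod>j<n. if j \<in> S then 1 - q else q)"
proof -
  let ?L = "cell \<theta> p"
  define \<psi> :: "(real ^ 'd) \<times> real \<Rightarrow> real" where "\<psi> z = s (fst z) * indicator ?L (fst z)" for z
  define \<phi> :: "nat \<Rightarrow> (real ^ 'd) \<times> real \<Rightarrow> real" where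
    "\<phi> j z = (if j = i then snd z else 1) *
       (if j \<in> S then indicator ?L (fst z) else 1 - indicator ?L (fst z))" for j z
  have [measurable]: "\<psi> \<in> borel_measurable (borel \<Otimes>\<^sub>M borel)"
      "\<phi> j \<in> borel_measurable (borel \<Otimes>\<^sub>M borel)" for j
    unfolding \<psi>_def \<phi>_def by measurable
  have \<psi>_int: "integrable M (\<lambda>\<omega>. \<psi> (X \<omega>, Y \<omega>))"
    by (rule integrable_const_bound[where B=1]) (auto simp: \<psi>_def indicator_def s_le)
  have \<phi>_int: "integrable M (\<lambda>\<omega>. \<phi> j (X \<omega>, Y \<omega>))" for j
  proof (rule Bochner_Integration.integrable_bound)
    \<comment> \<open>One dominating function for both cases: the bound is
      \<open>\<bar>Y \<omega>\<bar>\<close> at \<open>j = i\<close> and 1 elsewhere.\<close>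
    show "integrable M (\<lambda>\<omega>. 1 + \<bar>Y \<omega>\<bar>)" using Y_integrable by auto
  qed (auto simp: \<phi>_def indicator_def)
  have iS: "i < n" using i S by auto
  have Z: "Z = (\<lambda>\<omega>. \<psi> (X \<omega>, Y \<omega>) * (\<Prod>j<n. \<phi> j (Xs j \<omega>, Ys j \<omega>)))"
  proof
    fix \<omega>
    have "(\<Prod>j<n. \<phi> j (Xs j \<omega>, Ys j \<omega>)) = Ys i \<omega> * hit_pattern ?L S n (\<lambda>j. Xs j \<omega>)"
    proof -
      have "(\<Prod>j<n. if j = i then snd (Xs j \<omega>, Ys j \<omega>) else 1) = Ys i \<omega>"
        using iS by (subst prod.delta) auto
      then show ?thesis unfolding \<phi>_def prod.distrib hit_pattern_def fst_conv by (rule arg_cong)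
    qed
    then show "Z \<omega> = \<psi> (X \<omega>, Y \<omega>) * (\<Prod>j<n. \<phi> j (Xs j \<omega>, Ys j \<omega>))"
      by (simp add: Z_def \<psi>_def)
  qed
  show "integrable M Z"
    unfolding Z by (rule expectation_prod_sample(2)) (use \<psi>_int \<phi>_int in auto)
  have q: "expectation (\<lambda>\<omega>. indicator ?L (X \<omega>)) = 1 - q"
    unfolding q_def expectation_cell by simp
  have ind_int: "integrable M (\<lambda>\<omega>. indicator ?L (X \<omega>) :: real)"
    by (rule integrable_const_bound[where B=1]) auto
  have q': "expectation (\<lambda>\<omega>. 1 - indicator ?L (X \<omega>)) = q"
    using ind_int q prob_space by simp
  have q01: "0 \<le> q" "q \<le> 1" by (auto simp: q_def power_le_one)
  let ?H = "expectation (\<lambda>\<omega>. fstar (X \<omega>) * indicator ?L (X \<omega>))"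
  let ?G = "expectation (\<lambda>\<omega>. \<bar>fstar (X \<omega>)\<bar> * indicator ?L (X \<omega>))"
  \<comment> \<open>Since \<open>i \<in> S\<close>, the factor at \<open>i\<close> is
    \<open>Y\<close> times the indicator of the cell, so \<open>Y\<close> may be replaced by
    \<open>fstar\<close> there.\<close>
  have E\<phi>: "expectation (\<lambda>\<omega>. \<phi> j (X \<omega>, Y \<omega>)) = (if j = i then ?H else if j \<in> S then 1 - q else q)" for j
    using i by (auto simp: \<phi>_def q q' expectation_Y_cell)
  have H: "\<bar>?H\<bar> \<le> ?G"
    using integral_norm_bound[of M "\<lambda>\<omega>. fstar (X \<omega>) * indicator ?L (X \<omega>)"] by (simp add: abs_mult)
  have \<psi>: "\<bar>expectation (\<lambda>\<omega>. \<psi> (X \<omega>, Y \<omega>))\<bar> \<le> 1 - q"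
  proof -
    have "\<bar>expectation (\<lambda>\<omega>. \<psi> (X \<omega>, Y \<omega>))\<bar> \<le> expectation (\<lambda>\<omega>. \<bar>\<psi> (X \<omega>, Y \<omega>)\<bar>)"
      using integral_norm_bound[of M "\<lambda>\<omega>. \<psi> (X \<omega>, Y \<omega>)"] by simp
    also have "\<dots> \<le> expectation (\<lambda>\<omega>. indicator ?L (X \<omega>))"
      using \<psi>_int ind_int s_le by (intro integral_mono) (auto simp: \<psi>_def indicator_def)
    finally show ?thesis unfolding q .
  qed
  let ?P = "\<Prod>j\<in>{..<n} - {i}. if j \<in> S then 1 - q else q"
  have P: "0 \<le> ?P" using q01 by (intro prod_nonneg) auto
  have "(\<Prod>j<n. if j = i then ?H else if j \<in> S then 1 - q else q) = ?H * ?P"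
    using iS by (subst prod.remove[of _ i]) (auto intro!: prod.cong)
  then have EZ: "expectation Z = expectation (\<lambda>\<omega>. \<psi> (X \<omega>, Y \<omega>)) * (?H * ?P)"
    unfolding Z using expectation_prod_sample(1)[of \<psi> \<phi> n] \<psi>_int \<phi>_int by (simp add: E\<phi>)
  have "expectation Z \<le> \<bar>expectation (\<lambda>\<omega>. \<psi> (X \<omega>, Y \<omega>))\<bar> * \<bar>?H * ?P\<bar>"
    unfolding EZ abs_mult[symmetric] by (rule abs_ge_self)
  also have "\<dots> = \<bar>expectation (\<lambda>\<omega>. \<psi> (X \<omega>, Y \<omega>))\<bar> * (\<bar>?H\<bar> * ?P)"
    unfolding abs_mult abs_of_nonneg[OF P] ..
  also have "\<dots> \<le> (1 - q) * (?G * ?P)"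
    using q01 P by (intro mult_mono[OF \<psi> mult_right_mono[OF H P]]) auto
  also have "\<dots> = ?G * ((1 - q) * ?P)" by simp
  \<comment> \<open>The bound for the test point fills the gap at \<open>i\<close>, which completes
    the product over all sample indices.\<close>
  also have "(1 - q) * ?P = (\<Prod>j<n. if j \<in> S then 1 - q else q)"
    using iS i prod.remove[of "{..<n}" i "\<lambda>j. if j \<in> S then 1 - q else q"] by simp
  finally show "expectation Z \<le> ?G * (\<Prod>j<n. if j \<in> S then 1 - q else q)" .
qed

text \<open>The bound for one summand does not depend on \<open>i\<close>, so averaging over
  \<open>S\<close> keeps it. It remains to sum the pattern probabilities over nonempty
  \<open>S\<close> and the integrals of \<open>\<bar>fstar\<bar>\<close> over the cells.\<close>

lemma expectation_tree_prediction:
  fixes \<theta> :: "bool list \<Rightarrow> 'd" and s :: "real ^ 'd \<Rightarrow> real" and k n :: nat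
  assumes s [measurable]: "s \<in> borel_measurable borel" and s_le: "\<And>x. \<bar>s x\<bar> \<le> 1"
  defines "Z \<equiv> \<lambda>\<omega>. s (X \<omega>) * tree_prediction \<theta> k n (\<lambda>i. Xs i \<omega>) (\<lambda>i. Ys i \<omega>) (X \<omega>)"
  shows "integrable M Z"
    and "expectation Z \<le> (1 - (1 - (1/2) ^ k) ^ n) * expectation (\<lambda>\<omega>. \<bar>fstar (X \<omega>)\<bar>)"
proof -
  define q :: real where "q = 1 - (1/2) ^ k"
  define T where "T p S i = (\<lambda>\<omega>. s (X \<omega>) * indicator (cell \<theta> p) (X \<omega>)
      * (Ys i \<omega> * hit_pattern (cell \<theta> p) S n (\<lambda>j. Xs j \<omega>)))" for p S i
  define G where "G p = expectation (\<lambda>\<omega>. \<bar>fstar (X \<omega>)\<bar> * indicator (cell \<theta> p) (X \<omega>))" for p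
  have Z: "Z = (\<lambda>\<omega>. \<Sum>p | length p = k. \<Sum>S\<in>Pow {..<n}. \<Sum>i\<in>S. T p S i \<omega> / card S)"
    by (simp add: Z_def T_def tree_prediction_eq sum_distrib_left mult_ac)
  have T_int: "integrable M (T p S i)" if "i \<in> S" "S \<in> Pow {..<n}" for p S i
    unfolding T_def by (rule expectation_hit_pattern(1)) (use that s_le in auto)
  have T_le: "expectation (T p S i) \<le> G p * (\<Prod>j<n. if j \<in> S then 1 - q else q)"
    if "i \<in> S" "S \<in> Pow {..<n}" "length p = k" for p S i
    using expectation_hit_pattern(2)[of s i S n \<theta> p] that s_le by (auto simp: T_def G_def q_def cong: if_cong)
  show "integrable M Z"
    unfolding Z using T_int by (intro Bochner_Integration.integrable_sum integrable_divide) auto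
  have "expectation Z = (\<Sum>p | length p = k. \<Sum>S\<in>Pow {..<n}. \<Sum>i\<in>S. expectation (T p S i) / card S)"
    unfolding Z using T_int
    by (subst Bochner_Integration.integral_sum;
        (intro Bochner_Integration.integrable_sum integrable_divide sum.cong refl)?; auto?)+
  \<comment> \<open>The empty pattern has an empty inner sum. Dropping it before estimating produces
    the factor \<open>1 - q ^ n\<close> in place of 1.\<close>
  also have "\<dots> = (\<Sum>p | length p = k. \<Sum>S\<in>Pow {..<n} - {{}}. \<Sum>i\<in>S. expectation (T p S i) / card S)"
    by (intro sum.cong refl sum.mono_neutral_right) auto
  also have "\<dots> \<le> (\<Sum>p | length p = k. \<Sum>S\<in>Pow {..<n} - {{}}. G p * (\<Prod>j<n. if j \<in> S then 1 - q else q))"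
  proof (intro sum_mono)
    fix p :: "bool list" and S assume p: "p \<in> {p. length p = k}" and S: "S \<in> Pow {..<n} - {{}}"
    let ?c = "G p * (\<Prod>j<n. if j \<in> S then 1 - q else q)"
    have "finite S" "S \<noteq> {}" using S by (auto intro: finite_subset)
    then have card: "card S > 0" by (simp add: card_gt_0_iff)
    have "(\<Sum>i\<in>S. expectation (T p S i) / card S) \<le> (\<Sum>i\<in>S. ?c / card S)"
      using T_le p S by (intro sum_mono divide_right_mono) auto
    also have "\<dots> = ?c" using card by simp
    finally show "(\<Sum>i\<in>S. expectation (T p S i) / card S) \<le> ?c" .
  qed
  also have "\<dots> = (1 - q ^ n) * (\<Sum>p | length p = k. G p)"
    by (simp add: sum_distrib_left[symmetric] sum_distrib_right[symmetric] sum_occupation mult.commute)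
  also have "\<dots> \<le> (1 - q ^ n) * expectation (\<lambda>\<omega>. \<bar>fstar (X \<omega>)\<bar>)"
  proof (rule mult_left_mono)
    have int: "integrable M (\<lambda>\<omega>. \<bar>fstar (X \<omega>)\<bar> * indicator (cell \<theta> p) (X \<omega>))" for p
      by (rule Bochner_Integration.integrable_bound[OF fstar_integrable]) (auto simp: indicator_def)
    have "(\<Sum>p | length p = k. G p)
        = expectation (\<lambda>\<omega>. \<Sum>p | length p = k. \<bar>fstar (X \<omega>)\<bar> * indicator (cell \<theta> p) (X \<omega>))"
      unfolding G_def using int by (subst Bochner_Integration.integral_sum) auto
    also have "\<dots> \<le> expectation (\<lambda>\<omega>. \<bar>fstar (X \<omega>)\<bar>)"
    proof (intro integral_mono)
      show "(\<Sum>p | length p = k. \<bar>fstar (X \<omega>)\<bar> * indicator (cell \<theta> p) (X \<omega>)) \<le> \<bar>fstar (X \<omega>)\<bar>" for \<omega>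
        using mult_left_mono[OF sum_indicator_cell_le[of \<theta> "X \<omega>" k], of "\<bar>fstar (X \<omega>)\<bar>"]
        by (simp add: sum_distrib_left)
    qed (use int fstar_integrable in auto)
    finally show "(\<Sum>p | length p = k. G p) \<le> expectation (\<lambda>\<omega>. \<bar>fstar (X \<omega>)\<bar>)" .
    show "0 \<le> 1 - q ^ n" by (simp add: q_def power_le_one)
  qed
  finally show "expectation Z \<le> (1 - (1 - (1/2) ^ k) ^ n) * expectation (\<lambda>\<omega>. \<bar>fstar (X \<omega>)\<bar>)"
    by (simp add: q_def)
qed

text \<open>The bound for a tree is the same for all \<open>\<theta>\<close>, so it passes to convex
  combinations.\<close>

lemma expectation_infinite_crf:
  fixes s :: "real ^ 'd \<Rightarrow> real" and k n :: nat
  assumes s [measurable]: "s \<in> borel_measurable borel" and s_le: "\<And>x. \<bar>s x\<bar> \<le> 1"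
  defines "Z \<equiv> \<lambda>\<omega>. s (X \<omega>) * infinite_crf k n (\<lambda>i. Xs i \<omega>) (\<lambda>i. Ys i \<omega>) (X \<omega>)"
  shows "integrable M Z"
    and "expectation Z \<le> (1 - (1 - (1/2) ^ k) ^ n) * expectation (\<lambda>\<omega>. \<bar>fstar (X \<omega>)\<bar>)"
proof -
  let ?\<Theta> = "set_pmf (centered_splits k) :: (bool list \<Rightarrow> 'd) set"
  let ?B = "(1 - (1 - (1/2) ^ k) ^ n) * expectation (\<lambda>\<omega>. \<bar>fstar (X \<omega>)\<bar>)"
  define T where
    "T \<theta> = (\<lambda>\<omega>. s (X \<omega>) * tree_prediction \<theta> k n (\<lambda>i. Xs i \<omega>) (\<lambda>i. Ys i \<omega>) (X \<omega>))" for \<theta>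
  have Z: "Z = (\<lambda>\<omega>. \<Sum>\<theta>\<in>?\<Theta>. T \<theta> \<omega> * pmf (centered_splits k) \<theta>)"
    by (simp add: Z_def T_def infinite_crf_eq sum_distrib_left mult_ac)
  have T: "integrable M (T \<theta>)" "expectation (T \<theta>) \<le> ?B" for \<theta>
    unfolding T_def using expectation_tree_prediction[OF s s_le] by blast+
  show "integrable M Z"
    unfolding Z using T(1) by auto
  have "expectation Z = (\<Sum>\<theta>\<in>?\<Theta>. expectation (T \<theta>) * pmf (centered_splits k) \<theta>)"
    unfolding Z using T(1) by simp
  also have "\<dots> \<le> (\<Sum>\<theta>\<in>?\<Theta>. ?B * pmf (centered_splits k) \<theta>)"
    using T(2) by (intro sum_mono mult_right_mono) auto
  also have "\<dots> = ?B"
    using sum_pmf_eq_1[OF finite_set_centered_splits[of k, where 'd='d] subset_refl]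
    by (simp add: sum_distrib_left[symmetric])
  finally show "expectation Z \<le> ?B" .
qed

text \<open>In place of the Cauchy-Schwarz inequality, the square of the error is bounded below by a
  function linear in the error: \<open>g\<^sup>2 \<ge> - 2 * b * s * g - b\<^sup>2\<close> for
  \<open>\<bar>s\<bar> \<le> 1\<close>. Its integral needs only first moments, and the correlation
  bound makes it at least \<open>b\<^sup>2\<close>.\<close>

lemma excess_risk_infinite_crf_ge:
  "ennreal (((1 - (1/2) ^ k) ^ n * expectation (\<lambda>\<omega>. \<bar>fstar (X \<omega>)\<bar>))\<^sup>2)
    \<le> excess_risk M X fstar (\<lambda>\<omega>. infinite_crf k n (\<lambda>i. Xs i \<omega>) (\<lambda>i. Ys i \<omega>))"
proof -
  define b where "b = (1 - (1/2) ^ k) ^ n * expectation (\<lambda>\<omega>. \<bar>fstar (X \<omega>)\<bar>)"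
  define F where "F \<omega> = infinite_crf k n (\<lambda>i. Xs i \<omega>) (\<lambda>i. Ys i \<omega>) (X \<omega>)" for \<omega>
  define s where "s x = sgn (fstar x)" for x
  have s [measurable]: "s \<in> borel_measurable borel"
    unfolding s_def by measurable
  have s_le: "\<bar>s x\<bar> \<le> 1" for x by (simp add: s_def sgn_if)
  have b0: "0 \<le> b" unfolding b_def by (auto simp: power_le_one)
  note crf = expectation_infinite_crf[OF s s_le, of k n, folded F_def]
  have abs: "\<bar>fstar x\<bar> = s x * fstar x" for x by (simp add: s_def sgn_if)
  have int: "integrable M (\<lambda>\<omega>. 2 * b * (\<bar>fstar (X \<omega>)\<bar> - s (X \<omega>) * F \<omega>) - b\<^sup>2)"
    using crf(1) fstar_integrable by auto
  have "b \<le> expectation (\<lambda>\<omega>. \<bar>fstar (X \<omega>)\<bar>) - expectation (\<lambda>\<omega>. s (X \<omega>) * F \<omega>)"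
    using crf(2) by (simp add: b_def algebra_simps)
  then have "2 * b * b - b\<^sup>2
      \<le> 2 * b * (expectation (\<lambda>\<omega>. \<bar>fstar (X \<omega>)\<bar>) - expectation (\<lambda>\<omega>. s (X \<omega>) * F \<omega>)) - b\<^sup>2"
    using b0 by (intro diff_right_mono mult_left_mono) auto
  also have "\<dots> = expectation (\<lambda>\<omega>. 2 * b * (\<bar>fstar (X \<omega>)\<bar> - s (X \<omega>) * F \<omega>) - b\<^sup>2)"
      proof -
    have "integrable M (\<lambda>\<omega>. \<bar>fstar (X \<omega>)\<bar> - s (X \<omega>) * F \<omega>)"
      using crf(1) fstar_integrable by auto
    then have "expectation (\<lambda>\<omega>. 2 * b * (\<bar>fstar (X \<omega>)\<bar> - s (X \<omega>) * F \<omega>) - b\<^sup>2)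
        = 2 * b * expectation (\<lambda>\<omega>. \<bar>fstar (X \<omega>)\<bar> - s (X \<omega>) * F \<omega>) - b\<^sup>2"
      using prob_space by (subst Bochner_Integration.integral_diff) auto
    then show ?thesis
      using crf(1) fstar_integrable by (subst (asm) (2) Bochner_Integration.integral_diff) auto
  qed
  finally have "b\<^sup>2 \<le> expectation (\<lambda>\<omega>. 2 * b * (\<bar>fstar (X \<omega>)\<bar> - s (X \<omega>) * F \<omega>) - b\<^sup>2)"
    by (simp add: power2_eq_square)
  \<comment> \<open>The linear minorant may be negative; its positive part allows the passage to the
    nonnegative integral.\<close>
  also have "\<dots> \<le> expectation (\<lambda>\<omega>. max 0 (2 * b * (\<bar>fstar (X \<omega>)\<bar> - s (X \<omega>) * F \<omega>) - b\<^sup>2))"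
    using int by (intro integral_mono) auto
  finally have "ennreal (b\<^sup>2)
      \<le> ennreal (expectation (\<lambda>\<omega>. max 0 (2 * b * (\<bar>fstar (X \<omega>)\<bar> - s (X \<omega>) * F \<omega>) - b\<^sup>2)))"
    by (rule ennreal_leI)
  also have "\<dots> = (\<integral>\<^sup>+ \<omega>. ennreal (max 0 (2 * b * (\<bar>fstar (X \<omega>)\<bar> - s (X \<omega>) * F \<omega>) - b\<^sup>2)) \<partial>M)"
    using int by (intro nn_integral_eq_integral[symmetric]) auto
  also have "\<dots> \<le> (\<integral>\<^sup>+ \<omega>. ennreal ((F \<omega> - fstar (X \<omega>))\<^sup>2) \<partial>M)"
  proof (intro nn_integral_mono ennreal_leI)
    fix \<omega>
    let ?g = "F \<omega> - fstar (X \<omega>)"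
    have "(s (X \<omega>))\<^sup>2 \<le> 1" using s_le[of "X \<omega>"] by (simp add: abs_square_le_1)
    then have "b\<^sup>2 * (s (X \<omega>))\<^sup>2 \<le> b\<^sup>2" by (simp add: mult_left_le)
    \<comment> \<open>Expanding this square gives the minorant; \<open>s\<close> vanishes at zeros
      of \<open>fstar\<close>, hence the separate estimate of
      \<open>b\<^sup>2 * (s (X \<omega>))\<^sup>2\<close>.\<close>
    moreover have "0 \<le> (?g + b * s (X \<omega>))\<^sup>2" by simp
    ultimately have "- (2 * b * (s (X \<omega>) * ?g)) - b\<^sup>2 \<le> ?g\<^sup>2"
      by (simp add: power2_sum power_mult_distrib mult_ac)
    then show "max 0 (2 * b * (\<bar>fstar (X \<omega>)\<bar> - s (X \<omega>) * F \<omega>) - b\<^sup>2) \<le> ?g\<^sup>2"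
      by (simp add: abs algebra_simps)
  qed
  finally show ?thesis by (simp add: excess_risk_def b_def F_def)
qed

text \<open>Positivity of the first or of the second absolute moment says the same:
  \<open>fstar (X \<omega>)\<close> is not almost surely 0. This includes an infinite second
  moment.\<close>

lemma expectation_abs_fstar_pos:
  assumes "(\<integral>\<^sup>+ \<omega>. ennreal ((fstar (X \<omega>))\<^sup>2) \<partial>M) > 0"
  shows "expectation (\<lambda>\<omega>. \<bar>fstar (X \<omega>)\<bar>) > 0"
proof (rule ccontr)
  assume "\<not> ?thesis"
  moreover have "expectation (\<lambda>\<omega>. \<bar>fstar (X \<omega>)\<bar>) \<ge> 0" by simp
  ultimately have "expectation (\<lambda>\<omega>. \<bar>fstar (X \<omega>)\<bar>) = 0" by linarith
  then have "AE \<omega> in M. \<bar>fstar (X \<omega>)\<bar> = 0"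
    using fstar_integrable by (subst (asm) integral_nonneg_eq_0_iff_AE) auto
  then have "(\<integral>\<^sup>+ \<omega>. ennreal ((fstar (X \<omega>))\<^sup>2) \<partial>M) = 0"
    by (subst nn_integral_0_iff_AE) (auto elim!: eventually_mono)
  with assms show False by simp
qed

end

theorem proposition3p5:
  fixes M :: "'a measure" and X :: "'a \<Rightarrow> real ^ 'd" and Y eps :: "'a \<Rightarrow> real"
    and fstar :: "real ^ 'd \<Rightarrow> real" and \<sigma> \<alpha> :: real
    and Xs :: "nat \<Rightarrow> 'a \<Rightarrow> real ^ 'd" and Ys :: "nat \<Rightarrow> 'a \<Rightarrow> real"
    and k :: "nat \<Rightarrow> nat"
  assumes "regression_setting M X Y eps fstar \<sigma> Xs Ys"
    and "(\<integral>\<^sup>+ \<omega>. ennreal ((fstar (X \<omega>))\<^sup>2) \<partial>M) > 0"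
    and "\<alpha> > 0"
    and "\<And>n. n \<ge> 1 \<Longrightarrow> real (k n) \<ge> log 2 (\<alpha> * real n)"
  shows "\<not> consistent M X fstar
            (\<lambda>n \<omega>. infinite_crf (k n) n (\<lambda>i. Xs i \<omega>) (\<lambda>i. Ys i \<omega>))"
proof
  assume cons: "consistent M X fstar (\<lambda>n \<omega>. infinite_crf (k n) n (\<lambda>i. Xs i \<omega>) (\<lambda>i. Ys i \<omega>))"
  interpret regression_setting M X Y eps fstar \<sigma> Xs Ys by (rule assms(1))
  define m where "m = expectation (\<lambda>\<omega>. \<bar>fstar (X \<omega>)\<bar>)"
  define R where
    "R = (\<lambda>n. excess_risk M X fstar (\<lambda>\<omega>. infinite_crf (k n) n (\<lambda>i. Xs i \<omega>) (\<lambda>i. Ys i \<omega>)))"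
  have m: "m > 0" unfolding m_def by (rule expectation_abs_fstar_pos[OF assms(2)])
  have R0: "R \<longlonglongrightarrow> 0" using cons by (simp add: consistent_def R_def)
  \<comment> \<open>The depth condition gives \<open>(1/2) ^ k n \<le> 1 / (\<alpha> * n)\<close>,
    so the risk bound dominates this sequence, whose limit is positive.\<close>
  have "(\<lambda>n. ((1 + (- 1 / \<alpha>) / real n) ^ n * m)\<^sup>2) \<longlonglongrightarrow> (exp (- 1 / \<alpha>) * m)\<^sup>2"
    by (intro tendsto_intros tendsto_exp_limit_sequentially)
  then have lim: "(\<lambda>n. ennreal (((1 + (- 1 / \<alpha>) / real n) ^ n * m)\<^sup>2))
      \<longlonglongrightarrow> ennreal ((exp (- 1 / \<alpha>) * m)\<^sup>2)"
    by (rule tendsto_ennrealI)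
  have "eventually (\<lambda>n. ennreal (((1 + (- 1 / \<alpha>) / real n) ^ n * m)\<^sup>2) \<le> R n) sequentially"
    \<comment> \<open>From \<open>n \<ge> 1 / \<alpha>\<close> on, the base
      \<open>1 - 1 / (\<alpha> * n)\<close> is nonnegative, as monotonicity of the power requires;
      \<open>n \<ge> 1\<close> is the range of the depth condition.\<close>
    using eventually_ge_at_top[of "nat \<lceil>1 / \<alpha>\<rceil>"] eventually_ge_at_top[of 1]
  proof eventually_elim
    case (elim n)
    have n: "n \<ge> 1" "1 / \<alpha> \<le> real n" using elim by linarith+
    have an: "1 \<le> \<alpha> * real n" using n assms(3) by (simp add: field_simps)
    have "\<alpha> * real n = 2 powr log 2 (\<alpha> * real n)" using an by simp
    also have "\<dots> \<le> 2 powr real (k n)" using assms(4)[OF n(1)] by (intro powr_mono) auto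
    finally have "\<alpha> * real n \<le> 2 ^ k n" by (simp add: powr_realpow)
    then have "(1/2) ^ k n \<le> 1 / (\<alpha> * real n)"
      using an by (simp add: field_simps)
    then have "1 + (- 1 / \<alpha>) / real n \<le> 1 - (1/2) ^ k n" by simp
    moreover have "0 \<le> 1 + (- 1 / \<alpha>) / real n" using an by (simp add: field_simps)
    ultimately have "((1 + (- 1 / \<alpha>) / real n) ^ n * m)\<^sup>2 \<le> ((1 - (1/2) ^ k n) ^ n * m)\<^sup>2"
      using m by (intro power_mono mult_right_mono) auto
    then show ?case
      using excess_risk_infinite_crf_ge[of "k n" n] unfolding R_def m_def
      by (meson ennreal_leI order_trans)
  qed
  from tendsto_le[OF _ R0 lim this] have "ennreal ((exp (- 1 / \<alpha>) * m)\<^sup>2) = 0" by simp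
  with m show False by (simp add: ennreal_eq_0_iff)
qed

end
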